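(* Let $k\ge 2$ and let $n\ge 2$ be even. Then the digraph $\mathrm{DPillar}_{n,k}$ is a Cayley graph; that is, there exist a group $G$, a bijection between the nodes of $\mathrm{DPillar}_{n,k}$ and the elements of $G$, and a generating subset $S\subseteq G$ closed under inverses such that, identifying nodes with group elements via the bijection, for all nodes $u,v$ the pair $(u,v)$ is a directed edge if and only if $us=v$ for some $s\in S$.
   Context: For $k\ge 2$ and even $n\ge 2$, the digraph $\mathrm{DPillar}_{n,k}$ is defined as follows. Its nodes (servers) are the pairs $(c,v_{k-1}v_{k-2}\ldots v_0)$ with $0\le c\le k-1$ and $0\le v_i\le \frac n2-1$ for all $0\le i\le k-1$; $c$ is called the column-index and $v_{k-1}\ldots v_0$ the row-index, and $v_i$ is called the bit in position $i$. Column-indices and bit positions are taken modulo $k$. From a node $(c,v_{k-1}\ldots v_0)$ there are directed edges to the following nodes, where $*$ denotes an arbitrary value in $\{0,1,\ldots,\frac n2-1\}$: (i) clockwise edges (c-edges): to the node in column $c+1$ whose row-index is obtained by replacing $v_c$ with $*$; (ii) anti-clockwise edges (a-edges): to the node in column $c-1$ whose row-index is obtained by replacing $v_{c-1}$ with $*$; (iii) basic static edges (b-edges): to the node in column $c$ whose row-index is obtained by replacing $v_c$ with $*\ne v_c$; (iv) decremented static edges (d-edges): to the node in column $c$ whose row-index is obtained by replacing $v_{c-1}$ with $*\neq v_{c-1}$. There are no loops, and all edges come in oppositely oriented pairs. *)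

theory Defs
  imports "Graph_Theory.Pair_Digraph" "HOL-Algebra.Generated_Groups"
begin

text \<open>
  A node is a pair of a column-index and a row-index.  The row-index v_(k-1) ... v_0 is the
  function sending i to v_i, extended by \<^term>\<open>undefined\<close> outside {0..k-1}, so that
  distinct functions are distinct row-indices.
\<close>

type_synonym dpillar_node = "nat \<times> (nat \<Rightarrow> nat)"

definition dpillar_nodes :: "nat \<Rightarrow> nat \<Rightarrow> dpillar_node set" where
  "dpillar_nodes n k = {..<k} \<times> ({..<k} \<rightarrow>\<^sub>E {..<n div 2})"

definition next_col :: "nat \<Rightarrow> nat \<Rightarrow> nat" where
  "next_col k c = (c + 1) mod k"

text \<open>
  Since subtraction on \<^typ>\<open>nat\<close> truncates, c - 1 modulo k is written as c + (k - 1) modulo k.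
\<close>

definition prev_col :: "nat \<Rightarrow> nat \<Rightarrow> nat" where
  "prev_col k c = (c + (k - 1)) mod k"

definition c_edges :: "nat \<Rightarrow> nat \<Rightarrow> dpillar_node rel" where
  "c_edges n k =
     {((c, v), (next_col k c, v(c := x))) | c v x.
        (c, v) \<in> dpillar_nodes n k \<and> x < n div 2}"

definition a_edges :: "nat \<Rightarrow> nat \<Rightarrow> dpillar_node rel" where
  "a_edges n k =
     {((c, v), (prev_col k c, v(prev_col k c := x))) | c v x.
        (c, v) \<in> dpillar_nodes n k \<and> x < n div 2}"

definition b_edges :: "nat \<Rightarrow> nat \<Rightarrow> dpillar_node rel" where
  "b_edges n k =
     {((c, v), (c, v(c := x))) | c v x.
        (c, v) \<in> dpillar_nodes n k \<and> x < n div 2 \<and> x \<noteq> v c}"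

definition d_edges :: "nat \<Rightarrow> nat \<Rightarrow> dpillar_node rel" where
  "d_edges n k =
     {((c, v), (c, v(prev_col k c := x))) | c v x.
        (c, v) \<in> dpillar_nodes n k \<and> x < n div 2 \<and> x \<noteq> v (prev_col k c)}"

definition DPillar :: "nat \<Rightarrow> nat \<Rightarrow> dpillar_node pair_pre_digraph" where
  "DPillar n k =
     \<lparr> pverts = dpillar_nodes n k,
       parcs = c_edges n k \<union> a_edges n k \<union> b_edges n k \<union> d_edges n k \<rparr>"

text \<open>
  HOL cannot quantify over the type of the group elements.  Taking them from the vertex type
  loses no generality: the carrier is in bijection with the vertices, so a group over any other
  type can be transported to the vertex type.
\<close>

definition is_Cayley_graph :: "'a pair_pre_digraph \<Rightarrow> bool" where
  "is_Cayley_graph D \<longleftrightarrow>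
     (\<exists>(G :: 'a monoid) \<phi> S.
        group G \<and>
        bij_betw \<phi> (pverts D) (carrier G) \<and>
        S \<subseteq> carrier G \<and>
        generate G S = carrier G \<and>
        (\<forall>s\<in>S. inv\<^bsub>G\<^esub> s \<in> S) \<and>
        (\<forall>u\<in>pverts D. \<forall>v\<in>pverts D.
           (u, v) \<in> parcs D \<longleftrightarrow> (\<exists>s\<in>S. \<phi> u \<otimes>\<^bsub>G\<^esub> s = \<phi> v)))"

end

theory Submission
  imports Defs
begin

text \<open>
  Adding a fixed vector modulo n/2 to the row-indices, and rotating columns and bit positions
  simultaneously, are automorphisms.  Together they form a copy of the wreath product of the
  cyclic group of order n/2 by the cyclic group of order k, which acts regularly on the
  nodes; so the nodes themselves carry this group structure, with left translations being
  automorphisms, and the connection set is the set of out-neighbours of the identity.  It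
  generates because every node is reached by going round the pillar along c-edges, correcting
  one bit per step.
\<close>

text \<open>Translating an arc from \<open>u\<close> to \<open>v\<close> by the inverse of
  \<open>u\<close> puts its tail at the identity, so all arcs are determined by the out-neighbours
  \<open>S\<close> of the identity. Symmetry of the arcs closes \<open>S\<close> under inverses, and
  a walk from the identity spells its endpoint as a word in \<open>S\<close>.\<close>

lemma is_Cayley_graph_if_left_translations:
  fixes G :: "'a monoid"
  assumes "group G"
    and verts: "pverts D = carrier G"
    and sub: "parcs D \<subseteq> carrier G \<times> carrier G"
    and sym: "sym (parcs D)"
    and left: "\<And>g u v. \<lbrakk>g \<in> carrier G; (u, v) \<in> parcs D\<rbrakk> \<Longrightarrow> (g \<otimes>\<^bsub>G\<^esub> u, g \<otimes>\<^bsub>G\<^esub> v) \<in> parcs D"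
    and conn: "\<And>u. u \<in> carrier G \<Longrightarrow> (\<one>\<^bsub>G\<^esub>, u) \<in> (parcs D)\<^sup>*"
  shows "is_Cayley_graph D"
proof -
  interpret group G by fact
  define S where "S = {s. (\<one>\<^bsub>G\<^esub>, s) \<in> parcs D}"
  have S: "S \<subseteq> carrier G"
    using sub by (auto simp: S_def)
  have arc: "(u, v) \<in> parcs D \<longleftrightarrow> (\<exists>s\<in>S. u \<otimes>\<^bsub>G\<^esub> s = v)" if "u \<in> carrier G" "v \<in> carrier G" for u v
  proof
    assume "(u, v) \<in> parcs D"
    then have "inv\<^bsub>G\<^esub> u \<otimes>\<^bsub>G\<^esub> v \<in> S"
      using left[of "inv\<^bsub>G\<^esub> u" u v] that by (simp add: S_def)
    moreover have "u \<otimes>\<^bsub>G\<^esub> (inv\<^bsub>G\<^esub> u \<otimes>\<^bsub>G\<^esub> v) = v"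
      using that by (simp add: m_assoc[symmetric])
    ultimately show "\<exists>s\<in>S. u \<otimes>\<^bsub>G\<^esub> s = v" by blast
  next
    assume "\<exists>s\<in>S. u \<otimes>\<^bsub>G\<^esub> s = v"
    then show "(u, v) \<in> parcs D"
      using left[of u "\<one>\<^bsub>G\<^esub>"] that by (auto simp: S_def)
  qed
  have inv: "inv\<^bsub>G\<^esub> s \<in> S" if "s \<in> S" for s
  proof -
    have s: "s \<in> carrier G" using that S by blast
    have "(inv\<^bsub>G\<^esub> s, \<one>\<^bsub>G\<^esub>) \<in> parcs D"
      using left[of "inv\<^bsub>G\<^esub> s" "\<one>\<^bsub>G\<^esub>" s] that s by (simp add: S_def)
    then show ?thesis
      using sym by (auto simp: S_def dest: symD)
  qed
  have "u \<in> generate G S" if "(\<one>\<^bsub>G\<^esub>, u) \<in> (parcs D)\<^sup>*" for u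
    using that
  proof induction
    case base
    show ?case by (rule generate.one)
  next
    case (step y z)
    then obtain s where "s \<in> S" "y \<otimes>\<^bsub>G\<^esub> s = z"
      using arc[of y z] sub by blast
    then show ?case
      using step.IH by (blast intro: generate.eng generate.incl)
  qed
  then have "generate G S = carrier G"
    using conn generate_incl[OF S] by blast
  with S inv arc show ?thesis
    unfolding is_Cayley_graph_def verts
    by (intro exI[of _ G] exI[of _ "\<lambda>u. u"] exI[of _ S]) (auto simp: group_axioms bij_betw_def)
qed

text \<open>With \<open>g = (a, f)\<close>, this rotates \<open>v\<close> by \<open>a\<close>
  positions and then adds \<open>f\<close> modulo \<open>m\<close>. Adding \<open>k\<close> first
  keeps the subtraction from truncating when \<open>a < k\<close>.\<close>

definition row_act :: "nat \<Rightarrow> nat \<Rightarrow> dpillar_node \<Rightarrow> (nat \<Rightarrow> nat) \<Rightarrow> nat \<Rightarrow> nat" where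
  "row_act m k g v = (\<lambda>i\<in>{..<k}. (snd g i + v ((i + k - fst g) mod k)) mod m)"

definition DPillar_group :: "nat \<Rightarrow> nat \<Rightarrow> dpillar_node monoid" where
  "DPillar_group n k =
     \<lparr> carrier = dpillar_nodes n k,
       mult = (\<lambda>g u. ((fst g + fst u) mod k, row_act (n div 2) k g (snd u))),
       one = (0, \<lambda>i\<in>{..<k}. 0) \<rparr>"

section \<open>Arithmetic of rotations and of bit translations\<close>

lemma diff_mod_eq_iff:
  fixes a c i k :: nat
  assumes "a < k" "c < k" "i < k"
  shows "(i + k - a) mod k = c \<longleftrightarrow> i = (a + c) mod k"
  using assms by (auto simp: mod_if)

text \<open>Rotations compose additively; associativity of the group rests on this.\<close>

lemma diff_diff_mod_eq:
  fixes a c i k :: nat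
  assumes "a < k" "c < k" "i < k"
  shows "((i + k - a) mod k + k - c) mod k = (i + k - (a + c) mod k) mod k"
  using assms by (auto simp: mod_if)

lemma diff_minus_mod_eq:
  fixes a i k :: nat
  assumes "a < k" "i < k"
  shows "(i + k - (k - a) mod k) mod k = (i + a) mod k"
  using assms by (auto simp: mod_if)

text \<open>This lets translations respect the condition that a static edge really changes a bit.
  Taking x \<le> y makes \<open>y - x\<close> a true difference; being below \<open>m\<close>, it is
  divisible by \<open>m\<close> only if zero.\<close>

lemma add_mod_cancel_left:
  fixes a x y m :: nat
  assumes "x < m" "y < m"
  shows "(a + x) mod m = (a + y) mod m \<longleftrightarrow> x = y"
  using assms
proof (induction x y rule: linorder_wlog)
  case (le x y)
  then have "(a + y) mod m = (a + x) mod m \<longleftrightarrow> m dvd y - x"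
    by (subst mod_eq_dvd_iff_nat) auto
  with le show ?case
    by (auto dest: dvd_imp_le)
qed auto

text \<open>The position of a changed bit is shifted by \<open>fst g\<close>, exactly as the column
  is. Hence the position keeps its offset from the column, which is all that the four edge kinds
  refer to.\<close>

lemma row_act_upd:
  assumes "fst g < k" "c < k"
  shows "row_act m k g (v(c := x)) =
    (row_act m k g v)((fst g + c) mod k := (snd g ((fst g + c) mod k) + x) mod m)"
  using assms by (auto simp: row_act_def fun_eq_iff diff_mod_eq_iff)

lemma row_act_apply:
  assumes "fst g < k" "c < k"
  shows "row_act m k g v ((fst g + c) mod k) = (snd g ((fst g + c) mod k) + v c) mod m"
proof -
  have "((fst g + c) mod k + k - fst g) mod k = c"
    using assms by (subst diff_mod_eq_iff) auto
  then show ?thesis using assms by (simp add: row_act_def)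
qed

context
  fixes n k :: nat
  assumes k: "2 \<le> k" and n: "2 \<le> n"
begin

section \<open>The group axioms\<close>

lemma group_DPillar_group: "group (DPillar_group n k)"
proof (rule groupI)
  let ?G = "DPillar_group n k" and ?m = "n div 2"
  have m: "?m > 0" using n by simp
  show "\<one>\<^bsub>?G\<^esub> \<in> carrier ?G"
    using k m by (auto simp: DPillar_group_def dpillar_nodes_def)
  show "x \<otimes>\<^bsub>?G\<^esub> y \<in> carrier ?G" if "x \<in> carrier ?G" "y \<in> carrier ?G" for x y
    using k m by (auto simp: DPillar_group_def dpillar_nodes_def row_act_def)
  show "x \<otimes>\<^bsub>?G\<^esub> y \<otimes>\<^bsub>?G\<^esub> z = x \<otimes>\<^bsub>?G\<^esub> (y \<otimes>\<^bsub>?G\<^esub> z)"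
    if "x \<in> carrier ?G" "y \<in> carrier ?G" "z \<in> carrier ?G" for x y z
  proof -
    obtain a f b g c h where xyz: "x = (a, f)" "y = (b, g)" "z = (c, h)"
      by (metis surj_pair)
    have ab: "a < k" "b < k"
      using that by (auto simp: xyz DPillar_group_def dpillar_nodes_def)
    have "row_act ?m k (fst (x \<otimes>\<^bsub>?G\<^esub> y), row_act ?m k x g) h i = row_act ?m k x (row_act ?m k y h) i"
      for i
    proof (cases "i < k")
      case True
      with ab diff_diff_mod_eq[of a k b i] show ?thesis
        by (simp add: xyz DPillar_group_def row_act_def mod_add_left_eq mod_add_right_eq add.assoc)
    qed (simp add: row_act_def)
    then show ?thesis
      by (simp add: xyz DPillar_group_def fun_eq_iff mod_add_left_eq mod_add_right_eq add.assoc)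
  qed
  show "\<one>\<^bsub>?G\<^esub> \<otimes>\<^bsub>?G\<^esub> x = x" if "x \<in> carrier ?G" for x
  proof -
    obtain a f where x: "x = (a, f)" by force
    have a: "a < k" and f: "f \<in> {..<k} \<rightarrow>\<^sub>E {..<?m}"
      using that by (auto simp: x DPillar_group_def dpillar_nodes_def)
    have "row_act ?m k \<one>\<^bsub>?G\<^esub> f i = f i" for i
      using PiE_mem[OF f, of i] PiE_arb[OF f, of i] by (simp add: DPillar_group_def row_act_def)
    with a show ?thesis
      by (simp add: x DPillar_group_def fun_eq_iff)
  qed
  show "\<exists>y\<in>carrier ?G. y \<otimes>\<^bsub>?G\<^esub> x = \<one>\<^bsub>?G\<^esub>" if "x \<in> carrier ?G" for x
  proof -
    obtain a f where x: "x = (a, f)" by force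
    have a: "a < k" and f: "\<And>i. i < k \<Longrightarrow> f i < ?m"
      using that by (auto simp: x DPillar_group_def dpillar_nodes_def)
    \<comment> \<open>The row of \<open>y\<close> is the negative of \<open>f\<close>, rotated back
      by \<open>a\<close>. The outer \<open>mod\<close> matters when \<open>a = 0\<close> or a bit
      of \<open>f\<close> is 0, where the bare difference would be \<open>k\<close> or
      \<open>?m\<close>, out of range.\<close>
    define y where "y = ((k - a) mod k, \<lambda>i\<in>{..<k}. (?m - f ((i + a) mod k)) mod ?m)"
    have "y \<in> carrier ?G"
      using k m by (auto simp: y_def DPillar_group_def dpillar_nodes_def)
    moreover have "((k - a) mod k + a) mod k = 0"
      using a by (simp add: mod_add_left_eq)
    moreover have "row_act ?m k y f i = (\<lambda>i\<in>{..<k}. 0) i" for i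
    proof (cases "i < k")
      case True
      have "f ((i + a) mod k) < ?m"
        using k by (intro f) simp
      then have "((?m - f ((i + a) mod k)) mod ?m + f ((i + a) mod k)) mod ?m = 0"
        by (simp add: mod_add_left_eq)
      with True show ?thesis
        using diff_minus_mod_eq[OF a True] by (simp add: y_def row_act_def)
    qed (simp add: row_act_def)
    ultimately show ?thesis
      by (intro bexI[of _ y]) (simp_all add: x y_def DPillar_group_def fun_eq_iff)
  qed
qed

section \<open>Columns, edges and symmetry\<close>

lemma next_col_less: "next_col k c < k" and prev_col_less: "prev_col k c < k"
  using k by (simp_all add: next_col_def prev_col_def)

lemma next_prev_col:
  assumes "c < k"
  shows "next_col k (prev_col k c) = c" and "prev_col k (next_col k c) = c"
  using assms k by (auto simp: next_col_def prev_col_def mod_if)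

lemma next_col_add: "next_col k ((a + c) mod k) = (a + next_col k c) mod k"
  and prev_col_add: "prev_col k ((a + c) mod k) = (a + prev_col k c) mod k"
  by (simp_all add: next_col_def prev_col_def mod_Suc_eq mod_add_left_eq mod_add_right_eq add_ac)

lemma dpillar_nodes_upd:
  assumes "(c, v) \<in> dpillar_nodes n k" "d < k" "b < k" "x < n div 2"
  shows "(d, v(b := x)) \<in> dpillar_nodes n k"
  using assms by (auto simp: dpillar_nodes_def PiE_iff extensional_def)

lemma parcs_DPillar_subset: "parcs (DPillar n k) \<subseteq> dpillar_nodes n k \<times> dpillar_nodes n k"
  by (auto simp: DPillar_def c_edges_def a_edges_def b_edges_def d_edges_def
      next_col_less prev_col_less intro!: dpillar_nodes_upd)
     (auto simp: dpillar_nodes_def)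

text \<open>Targets are constrained by equations rather than written out, so that the rules also
  apply to nodes not literally in the shape of an edge's head.\<close>

lemma DPillar_c_arc:
  "\<lbrakk>(c, v) \<in> dpillar_nodes n k; x < n div 2; d = next_col k c; w = v(c := x)\<rbrakk>
    \<Longrightarrow> ((c, v), (d, w)) \<in> parcs (DPillar n k)"
  and DPillar_a_arc:
  "\<lbrakk>(c, v) \<in> dpillar_nodes n k; x < n div 2; d = prev_col k c; w = v(d := x)\<rbrakk>
    \<Longrightarrow> ((c, v), (d, w)) \<in> parcs (DPillar n k)"
  and DPillar_b_arc:
  "\<lbrakk>(c, v) \<in> dpillar_nodes n k; x < n div 2; x \<noteq> v c; w = v(c := x)\<rbrakk>
    \<Longrightarrow> ((c, v), (c, w)) \<in> parcs (DPillar n k)"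
  and DPillar_d_arc:
  "\<lbrakk>(c, v) \<in> dpillar_nodes n k; x < n div 2; x \<noteq> v (prev_col k c); w = v(prev_col k c := x)\<rbrakk>
    \<Longrightarrow> ((c, v), (c, w)) \<in> parcs (DPillar n k)"
  unfolding DPillar_def c_edges_def a_edges_def b_edges_def d_edges_def by auto

lemma DPillar_arc_cases [consumes 1, case_names c_arc a_arc b_arc d_arc]:
  assumes "(u, u') \<in> parcs (DPillar n k)"
  obtains
    c v x where "u = (c, v)" "u' = (next_col k c, v(c := x))" "(c, v) \<in> dpillar_nodes n k"
      "x < n div 2"
  | c v x where "u = (c, v)" "u' = (prev_col k c, v(prev_col k c := x))"
      "(c, v) \<in> dpillar_nodes n k" "x < n div 2"
  | c v x where "u = (c, v)" "u' = (c, v(c := x))" "(c, v) \<in> dpillar_nodes n k"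
      "x < n div 2" "x \<noteq> v c"
  | c v x where "u = (c, v)" "u' = (c, v(prev_col k c := x))" "(c, v) \<in> dpillar_nodes n k"
      "x < n div 2" "x \<noteq> v (prev_col k c)"
  using assms unfolding DPillar_def c_edges_def a_edges_def b_edges_def d_edges_def by auto

lemma dpillar_nodes_bit:
  assumes "(c, v) \<in> dpillar_nodes n k" "b < k"
  shows "v b < n div 2"
  using assms by (auto simp: dpillar_nodes_def)

text \<open>A c-edge leaving column \<open>c\<close> and an a-edge entering column \<open>c\<close>
  alter the same bit, so they reverse each other; b-edges and d-edges are reversed within their
  kind. In each case the reverse edge writes back the old bit.\<close>

lemma sym_parcs_DPillar: "sym (parcs (DPillar n k))"
proof (rule symI)
  fix u u' assume uu': "(u, u') \<in> parcs (DPillar n k)"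
  then have u': "u' \<in> dpillar_nodes n k"
    using parcs_DPillar_subset by blast
  from uu' show "(u', u) \<in> parcs (DPillar n k)"
  proof (cases rule: DPillar_arc_cases)
    case (c_arc c v x)
    then have c: "c < k" by (simp add: dpillar_nodes_def)
    show ?thesis
      unfolding c_arc(1,2)
      by (rule DPillar_a_arc[of _ _ "v c"])
        (use u' c in \<open>simp_all add: c_arc(2) next_prev_col dpillar_nodes_bit[OF c_arc(3)]\<close>)
  next
    case (a_arc c v x)
    then have c: "c < k" by (simp add: dpillar_nodes_def)
    show ?thesis
      unfolding a_arc(1,2)
      by (rule DPillar_c_arc[of _ _ "v (prev_col k c)"])
        (use u' c in \<open>simp_all add: a_arc(2) next_prev_col prev_col_less
          dpillar_nodes_bit[OF a_arc(3)]\<close>)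
  next
    case (b_arc c v x)
    then have c: "c < k" by (simp add: dpillar_nodes_def)
    show ?thesis
      unfolding b_arc(1,2)
      by (rule DPillar_b_arc[of _ _ "v c"])
        (use u' c b_arc(5) in \<open>simp_all add: b_arc(2) dpillar_nodes_bit[OF b_arc(3)]\<close>)
  next
    case (d_arc c v x)
    show ?thesis
      unfolding d_arc(1,2)
      by (rule DPillar_d_arc[of _ _ "v (prev_col k c)"])
        (use u' d_arc(5) in \<open>simp_all add: d_arc(2) prev_col_less dpillar_nodes_bit[OF d_arc(3)]\<close>)
  qed
qed

text \<open>Each edge kind is mapped to itself: column and altered position rotate together, and the
  new value is shifted by the bit of \<open>g\<close> at the rotated position.\<close>

lemma left_translation_DPillar:
  assumes g: "g \<in> dpillar_nodes n k" and uu': "(u, u') \<in> parcs (DPillar n k)"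
  shows "(g \<otimes>\<^bsub>DPillar_group n k\<^esub> u, g \<otimes>\<^bsub>DPillar_group n k\<^esub> u') \<in> parcs (DPillar n k)"
proof -
  let ?m = "n div 2" and ?a = "fst g"
  have m: "?m > 0" using n by simp
  have a: "?a < k" using g by (simp add: dpillar_nodes_def mem_Times_iff)
  have mult: "g \<otimes>\<^bsub>DPillar_group n k\<^esub> (c, v) = ((?a + c) mod k, row_act ?m k g v)" for c v
    by (simp add: DPillar_group_def)
  \<comment> \<open>No assumption on \<open>c\<close> or \<open>v\<close> is made: the reductions
    modulo \<open>k\<close> and \<open>?m\<close> and the restriction to \<open>{..<k}\<close>
    already force a node.\<close>
  have node: "((?a + c) mod k, row_act ?m k g v) \<in> dpillar_nodes n k" for c v
    using k m by (auto simp: dpillar_nodes_def row_act_def)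
  from uu' show ?thesis
  proof (cases rule: DPillar_arc_cases)
    case (c_arc c v x)
    then have c: "c < k" by (simp add: dpillar_nodes_def)
    show ?thesis
      unfolding c_arc(1,2) mult row_act_upd[OF a c]
      by (rule DPillar_c_arc[OF node mod_less_divisor[OF m]]) (simp_all add: next_col_add)
  next
    case (a_arc c v x)
    show ?thesis
      unfolding a_arc(1,2) mult row_act_upd[OF a prev_col_less]
      by (rule DPillar_a_arc[OF node mod_less_divisor[OF m]]) (simp_all add: prev_col_add)
  next
    case (b_arc c v x)
    then have c: "c < k" by (simp add: dpillar_nodes_def)
    show ?thesis
      unfolding b_arc(1,2) mult row_act_upd[OF a c]
      by (rule DPillar_b_arc[OF node mod_less_divisor[OF m] _ refl])
        \<comment> \<open>Old and new bit are shifted by the same amount modulo \<open>?m\<close>,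
          so they stay distinct.\<close>
        (use b_arc c a in \<open>simp add: row_act_apply add_mod_cancel_left dpillar_nodes_bit[OF b_arc(3)]\<close>)
  next
    case (d_arc c v x)
    show ?thesis
      unfolding d_arc(1,2) mult row_act_upd[OF a prev_col_less]
      by (rule DPillar_d_arc[OF node mod_less_divisor[OF m]])
        (use d_arc a in \<open>simp_all add: prev_col_add prev_col_less row_act_apply add_mod_cancel_left
          dpillar_nodes_bit[OF d_arc(3)]\<close>)
  qed
qed

lemma DPillar_reachable:
  assumes "u \<in> dpillar_nodes n k"
  shows "(\<one>\<^bsub>DPillar_group n k\<^esub>, u) \<in> (parcs (DPillar n k))\<^sup>*"
proof -
  obtain c v where u: "u = (c, v)" by force
  have v: "v \<in> {..<k} \<rightarrow>\<^sub>E {..<n div 2}" and c: "c < k"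
    using assms by (auto simp: u dpillar_nodes_def)
  have bit: "v b < n div 2" if "b < k" for b
    using v that by auto
  \<comment> \<open>After \<open>j\<close> steps along c-edges, the first \<open>j\<close> bits
    agree with \<open>v\<close> and the others are still 0.\<close>
  define w where "w j = (\<lambda>i\<in>{..<k}. if i < j then v i else 0)" for j
  have step: "((j mod k, w j), (Suc j mod k, w (Suc j))) \<in> parcs (DPillar n k)" for j
  proof (rule DPillar_c_arc)
    show "(j mod k, w j) \<in> dpillar_nodes n k"
      using k n bit by (auto simp: dpillar_nodes_def w_def)
    show "v (j mod k) < n div 2"
      using k bit by simp
    \<comment> \<open>From the second round on, the bit written is already correct; c-edges may
      leave the row-index unchanged.\<close>
    show "w (Suc j) = (w j)(j mod k := v (j mod k))"
      using k mod_less_eq_dividend[of j k]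
      by (auto simp: w_def fun_eq_iff less_Suc_eq intro: le_less_trans)
  qed (simp add: next_col_def mod_Suc_eq)
  have "(\<one>\<^bsub>DPillar_group n k\<^esub>, (j mod k, w j)) \<in> (parcs (DPillar n k))\<^sup>*" for j
  proof (induction j)
    case 0
    then show ?case by (simp add: DPillar_group_def w_def restrict_def)
  next
    case (Suc j)
    then show ?case using step by (rule rtrancl_into_rtrancl)
  qed
  \<comment> \<open>A full round of \<open>k\<close> steps fixes every bit; \<open>c\<close> further
    steps reach the right column.\<close>
  moreover have "w (k + c) = v"
    using v by (auto simp: w_def fun_eq_iff PiE_iff extensional_def)
  ultimately show ?thesis
    using c by (metis u mod_add_self1 mod_less)
qed

end

theorem lemma1:
  fixes n k :: nat
  assumes "k \<ge> 2" and "n \<ge> 2" and "even n"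
  shows "is_Cayley_graph (DPillar n k)"
proof (rule is_Cayley_graph_if_left_translations)
  have carrier: "carrier (DPillar_group n k) = dpillar_nodes n k"
    by (simp add: DPillar_group_def)
  show "group (DPillar_group n k)"
    using assms by (intro group_DPillar_group)
  show "pverts (DPillar n k) = carrier (DPillar_group n k)"
    by (simp add: DPillar_def carrier)
  show "parcs (DPillar n k) \<subseteq> carrier (DPillar_group n k) \<times> carrier (DPillar_group n k)"
    unfolding carrier using assms by (intro parcs_DPillar_subset)
  show "sym (parcs (DPillar n k))"
    using assms by (intro sym_parcs_DPillar)
  show "(g \<otimes>\<^bsub>DPillar_group n k\<^esub> u, g \<otimes>\<^bsub>DPillar_group n k\<^esub> v) \<in> parcs (DPillar n k)"
    if "g \<in> carrier (DPillar_group n k)" "(u, v) \<in> parcs (DPillar n k)" for g u v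
    using assms(1,2) that unfolding carrier by (rule left_translation_DPillar)
  show "(\<one>\<^bsub>DPillar_group n k\<^esub>, u) \<in> (parcs (DPillar n k))\<^sup>*"
    if "u \<in> carrier (DPillar_group n k)" for u
    using assms(1,2) that unfolding carrier by (rule DPillar_reachable)
qed

end
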